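(* Suppose that $\mathcal Z\subseteq\mathbb R^d$ is a bounded polyhedron with nonempty interior, and that for $\mathbb P_{\bm x}$-almost every $\bm x$, writing $\bar{\bm y}=\mathbb E_{\bm y\sim\mathbb P_{\bm y|\bm x}}[\bm y]$: the conditional distribution $\mathbb P_{\bm y|\bm x}$ is centrally symmetric about $\bar{\bm y}$ with $\mathbb E_{\bm y\sim\mathbb P_{\bm y|\bm x}}[\|\bm y\|_2]<\infty$ and has a density positive on an open set containing $2\bar{\bm y}$; and the nominal problem $\min_{\bm z\in\mathcal Z}\bar{\bm y}^\top\bm z$ admits a unique optimal solution. Then the $\mathcal{SPO}_+$ loss with $a=1$ is Fisher consistent with the $\mathcal{SPO}$ loss.
   Context: $(\bm x,\bm y)\sim\mathbb P$ with marginal $\mathbb P_{\bm x}$ and conditional distributions $\mathbb P_{\bm y|\bm x}$; $\bm x\in\mathcal X\subseteq\mathbb R^p$, $\bm y\in\mathbb R^d$. $\bm Z^\star(\bm y)=\operatorname{argmin}_{\bm z\in\mathcal Z}\bm y^\top\bm z$, $v^\star(\bm y)=\min_{\bm z\in\mathcal Z}\bm y^\top\bm z$, and $\bm z^\star(\bm y)\in\bm Z^\star(\bm y)$ is given by a fixed selection rule. $\mathcal{SPO}$ loss: $\ell_{\mathcal{SPO}}(\hat{\bm y},\bm y)=\max_{\bm z\in\bm Z^\star(\hat{\bm y})}\bm y^\top\bm z-v^\star(\bm y)$. $\mathcal{SPO}_+$ loss with parameter $a$: $\ell_{\mathcal{SPO}_+}(\hat{\bm y},\bm y)=\max_{\bm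 z\in\mathcal Z}\{\bm y^\top\bm z-a\hat{\bm y}^\top\bm z\}+a\,\bm z^\star(\bm y)^\top\hat{\bm y}-v^\star(\bm y)$. Fisher consistency of a loss $\ell$ with respect to $\ell_{\mathcal{SPO}}$ means that every minimizer of $\mathbb E_{\mathbb P}[\ell(\bm g(\bm x),\bm y)]$ over all measurable $\bm g:\mathcal X\to\mathbb R^d$ also minimizes $\mathbb E_{\mathbb P}[\ell_{\mathcal{SPO}}(\bm g(\bm x),\bm y)]$ over all measurable $\bm g$. It is understood pointwise: it amounts to the inclusion $\operatorname{argmin}_{\hat{\bm y}\in\mathbb R^d}\mathbb E_{\bm y\sim\mathbb P_{\bm y|\bm x}}[\ell(\hat{\bm y},\bm y)]\subseteq\operatorname{argmin}_{\hat{\bm y}\in\mathbb R^d}\mathbb E_{\bm y\sim\mathbb P_{\bm y|\bm x}}[\ell_{\mathcal{SPO}}(\hat{\bm y},\bm y)]$ for $\mathbb P_{\bm x}$-almost every $\bm x$. *)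

theory Defs
  imports "HOL-Probability.Probability"
begin

definition argmin_on :: "'a set \<Rightarrow> ('a \<Rightarrow> 'b::ord) \<Rightarrow> 'a set" where
  "argmin_on S f = {x. is_arg_min f (\<lambda>x. x \<in> S) x}"

definition opt_set :: "'a::euclidean_space set \<Rightarrow> 'a \<Rightarrow> 'a set" where
  "opt_set Z y = argmin_on Z (\<lambda>z. y \<bullet> z)"

text \<open>The infima and suprema below are over nonempty compact sets whenever \<open>Z\<close> is
  nonempty and compact, so they are the minima and maxima of the usual definitions.\<close>

definition opt_val :: "'a::euclidean_space set \<Rightarrow> 'a \<Rightarrow> real" where
  "opt_val Z y = (INF z\<in>Z. y \<bullet> z)"

definition spo_loss :: "'a::euclidean_space set \<Rightarrow> 'a \<Rightarrow> 'a \<Rightarrow> real" where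
  "spo_loss Z yhat y = (SUP z\<in>opt_set Z yhat. y \<bullet> z) - opt_val Z y"

definition spo_plus_loss ::
    "'a::euclidean_space set \<Rightarrow> ('a \<Rightarrow> 'a) \<Rightarrow> real \<Rightarrow> 'a \<Rightarrow> 'a \<Rightarrow> real" where
  "spo_plus_loss Z zstar a yhat y =
     (SUP z\<in>Z. y \<bullet> z - a * (yhat \<bullet> z)) + a * (zstar y \<bullet> yhat) - opt_val Z y"

lemma spo_loss_nonneg:
  assumes "compact Z" "Z \<noteq> {}"
  shows "0 \<le> spo_loss Z yhat y"
proof -
  have bdd: "bounded ((\<lambda>z. y \<bullet> z) ` Z)"
    by (intro compact_imp_bounded compact_continuous_image continuous_intros assms)
  have "continuous_on Z (\<lambda>z. yhat \<bullet> z)"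
    by (intro continuous_intros)
  then obtain z where z: "z \<in> Z" "\<forall>w\<in>Z. yhat \<bullet> z \<le> yhat \<bullet> w"
    using continuous_attains_inf[OF assms] by blast
  then have "z \<in> opt_set Z yhat"
    by (auto simp: opt_set_def argmin_on_def is_arg_min_def not_less)
  moreover have "opt_set Z yhat \<subseteq> Z"
    by (auto simp: opt_set_def argmin_on_def is_arg_min_def)
  ultimately have "y \<bullet> z \<le> (SUP z\<in>opt_set Z yhat. y \<bullet> z)"
    by (intro cSUP_upper bdd_above_mono[OF bounded_imp_bdd_above[OF bdd]] image_mono)
  moreover have "opt_val Z y \<le> y \<bullet> z"
    unfolding opt_val_def by (intro cINF_lower bounded_imp_bdd_below bdd z)
  ultimately show ?thesis
    by (simp add: spo_loss_def)
qed

lemma spo_plus_loss_nonneg: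
  assumes "compact Z" "zstar y \<in> opt_set Z y"
  shows "0 \<le> spo_plus_loss Z zstar a yhat y"
proof -
  have z: "zstar y \<in> Z"
    using assms(2) by (auto simp: opt_set_def argmin_on_def is_arg_min_def)
  have "bounded ((\<lambda>z. y \<bullet> z - a * (yhat \<bullet> z)) ` Z)" "bounded ((\<lambda>z. y \<bullet> z) ` Z)"
    by (intro compact_imp_bounded compact_continuous_image continuous_intros assms(1))+
  then have "y \<bullet> zstar y - a * (yhat \<bullet> zstar y) \<le> (SUP z\<in>Z. y \<bullet> z - a * (yhat \<bullet> z))"
    and "opt_val Z y \<le> y \<bullet> zstar y"
    unfolding opt_val_def
    by (auto intro!: cSUP_upper[OF z] cINF_lower[OF _ z] bounded_imp_bdd_above bounded_imp_bdd_below)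
  then show ?thesis
    by (simp add: spo_plus_loss_def inner_commute)
qed

text \<open>Expected loss with values in \<open>[0, \<infinity>]\<close>, for nonnegative losses only: both losses
  above are nonnegative, so \<^const>\<open>ennreal\<close> does not truncate them.\<close>

definition risk :: "'a measure \<Rightarrow> ('c \<Rightarrow> 'a \<Rightarrow> real) \<Rightarrow> 'c \<Rightarrow> ennreal" where
  "risk M l yhat = (\<integral>\<^sup>+ y. ennreal (l yhat y) \<partial>M)"

definition marginal_x :: "'x::topological_space set \<Rightarrow> ('x \<times> 'a) measure \<Rightarrow> 'x measure" where
  "marginal_x X P = distr P (restrict_space borel X) fst"

text \<open>\<open>K\<close> is a (regular) conditional distribution of the second component given the first.\<close>

definition conditional_distribution ::
    "'x::topological_space set \<Rightarrow> ('x \<times> 'a::topological_space) measure \<Rightarrow> ('x \<Rightarrow> 'a measure) \<Rightarrow> bool" where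
  "conditional_distribution X P K \<longleftrightarrow>
     K \<in> restrict_space borel X \<rightarrow>\<^sub>M prob_algebra borel \<and>
     (\<forall>A\<in>sets (restrict_space borel X). \<forall>B\<in>sets borel.
        emeasure P (A \<times> B) = (\<integral>\<^sup>+ x\<in>A. emeasure (K x) B \<partial>marginal_x X P))"

definition centrally_symmetric :: "'a::euclidean_space measure \<Rightarrow> 'a \<Rightarrow> bool" where
  "centrally_symmetric M c \<longleftrightarrow> distr M borel (\<lambda>y. y - c) = distr M borel (\<lambda>y. c - y)"

definition has_density_positive_around :: "'a::euclidean_space measure \<Rightarrow> 'a \<Rightarrow> bool" where
  "has_density_positive_around M c \<longleftrightarrow>
     (\<exists>f\<in>borel_measurable lborel. M = density lborel f \<and>
        (\<exists>U. open U \<and> c \<in> U \<and> (\<forall>y\<in>U. 0 < f y)))"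

text \<open>Fisher consistency in its pointwise form: the inclusion of the sets of minimizers of the
  conditional risks, for almost every value of the covariate.\<close>

definition fisher_consistent ::
    "'x measure \<Rightarrow> ('x \<Rightarrow> 'a measure) \<Rightarrow> ('a \<Rightarrow> 'a \<Rightarrow> real) \<Rightarrow> ('a \<Rightarrow> 'a \<Rightarrow> real) \<Rightarrow> bool" where
  "fisher_consistent Px K l l' \<longleftrightarrow>
     (AE x in Px. argmin_on UNIV (risk (K x) l) \<subseteq> argmin_on UNIV (risk (K x) l'))"

end

theory Submission
  imports Defs
begin

text \<open>Fix a covariate, let \<open>c\<close> be the conditional mean and \<open>h\<close> the support function of \<open>Z\<close>. With
  \<open>a = 1\<close> the \<open>SPO+\<close> risk is, up to a constant, \<open>yhat \<mapsto> E h (y - yhat) + E (zstar y) \<bullet> yhat\<close>,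
  a convex function. At \<open>yhat = 2 c\<close> it has the subgradient \<open>E (zstar y) - E (zstar (2 c - y))\<close>,
  which vanishes because \<open>2 c - y\<close> has the same distribution as \<open>y\<close>. Since \<open>Z\<close> has interior points,
  \<open>h\<close> is not affine near \<open>0\<close> in any direction, so positivity of the density near \<open>2 c\<close> makes
  \<open>2 c\<close> the only minimizer. Finally \<open>2 c\<close> and \<open>c\<close> define the same linear program, whose unique
  solution \<open>z0\<close> gives the \<open>SPO\<close> risk \<open>c \<bullet> z0 - E (opt_val Z y)\<close>, the smallest possible value.\<close>

section \<open>Support functions and linear programs\<close>

definition support_fun :: "'a::euclidean_space set \<Rightarrow> 'a \<Rightarrow> real" where
  "support_fun Z u = (SUP z\<in>Z. u \<bullet> z)"

lemma bounded_inner_image: "bounded Z \<Longrightarrow> bounded ((\<lambda>z. u \<bullet> z) ` Z)"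
  for Z :: "'a::real_inner set"
  by (rule bounded_linear_image) (auto intro: bounded_linear_inner_right)

lemma support_fun_upper: "bounded Z \<Longrightarrow> z \<in> Z \<Longrightarrow> u \<bullet> z \<le> support_fun Z u"
  unfolding support_fun_def
  by (intro cSUP_upper bounded_imp_bdd_above bounded_inner_image)

lemma support_fun_least: "Z \<noteq> {} \<Longrightarrow> (\<And>z. z \<in> Z \<Longrightarrow> u \<bullet> z \<le> b) \<Longrightarrow> support_fun Z u \<le> b"
  unfolding support_fun_def by (rule cSUP_least)

lemma support_fun_zero: "Z \<noteq> {} \<Longrightarrow> support_fun Z 0 = 0"
  by (simp add: support_fun_def)

lemma support_fun_scaleR:
  assumes "bounded Z" "Z \<noteq> {}" "0 \<le> t"
  shows "support_fun Z (t *\<^sub>R u) = t * support_fun Z u"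
proof (cases "t = 0")
  case True
  then show ?thesis using assms by (simp add: support_fun_zero)
next
  case False
  with assms have t: "0 < t" by simp
  have "support_fun Z (t *\<^sub>R u) \<le> t * support_fun Z u"
    using assms t by (intro support_fun_least) (auto intro: support_fun_upper)
  moreover have "support_fun Z u \<le> support_fun Z (t *\<^sub>R u) / t"
  proof (rule support_fun_least[OF assms(2)])
    fix z assume "z \<in> Z"
    with support_fun_upper[OF assms(1) this, of "t *\<^sub>R u"] t
    show "u \<bullet> z \<le> support_fun Z (t *\<^sub>R u) / t"
      by (simp add: field_simps)
  qed
  ultimately show ?thesis
    using t by (simp add: field_simps)
qed

text \<open>Cauchy-Schwarz bounds the change of \<open>u \<bullet> z\<close> uniformly over
  \<open>z\<close> in \<open>Z\<close>, so the supremum inherits the Lipschitz constant. Continuity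
  and linear growth of \<open>support_fun\<close> follow from this.\<close>

lemma support_fun_diff_le:
  assumes "Z \<noteq> {}" "bounded Z" "\<And>z. z \<in> Z \<Longrightarrow> norm z \<le> B"
  shows "\<bar>support_fun Z u - support_fun Z v\<bar> \<le> B * norm (u - v)"
proof -
  have "support_fun Z u \<le> support_fun Z v + B * norm (u - v)" for u v
  proof (rule support_fun_least[OF assms(1)])
    fix z assume z: "z \<in> Z"
    have "u \<bullet> z = v \<bullet> z + (u - v) \<bullet> z"
      by (simp add: inner_diff_left)
    also have "(u - v) \<bullet> z \<le> norm (u - v) * norm z"
      by (rule norm_cauchy_schwarz)
    also have "norm (u - v) * norm z \<le> norm (u - v) * B"
      by (intro mult_left_mono assms z) auto
    finally show "u \<bullet> z \<le> support_fun Z v + B * norm (u - v)"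
      using support_fun_upper[OF assms(2) z, of v] by (simp add: mult.commute)
  qed
  from this[of u v] this[of v u] show ?thesis
    by (simp add: norm_minus_commute)
qed

lemma continuous_on_support_fun:
  assumes "bounded Z" "Z \<noteq> {}"
  shows "continuous_on UNIV (support_fun Z)"
proof -
  obtain B where "\<And>z. z \<in> Z \<Longrightarrow> norm z \<le> B" "B > 0"
    using assms(1) unfolding bounded_pos by blast
  then have "B-lipschitz_on UNIV (support_fun Z)"
    using support_fun_diff_le[OF assms(2,1)]
    by (auto simp: lipschitz_on_def dist_norm)
  then show ?thesis
    by (rule lipschitz_on_continuous_on)
qed

lemma borel_measurable_support_fun [measurable (raw)]:
  assumes "bounded Z" "Z \<noteq> {}" "f \<in> borel_measurable M"
  shows "(\<lambda>x. support_fun Z (f x)) \<in> borel_measurable M"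
  using borel_measurable_continuous_on[OF continuous_on_support_fun[OF assms(1,2)] assms(3)] .

lemma integrable_support_fun:
  assumes "bounded Z" "Z \<noteq> {}" "integrable M f"
  shows "integrable M (\<lambda>x. support_fun Z (f x))"
proof -
  obtain B where B: "\<And>z. z \<in> Z \<Longrightarrow> norm z \<le> B" "B > 0"
    using assms(1) unfolding bounded_pos by blast
  have "\<bar>support_fun Z u\<bar> \<le> B * norm u" for u
    using support_fun_diff_le[OF assms(2,1) B(1), of u 0] by (simp add: support_fun_zero assms)
  then show ?thesis
    using assms B by (intro Bochner_Integration.integrable_bound[OF
          integrable_mult_right[OF integrable_norm[OF assms(3)]], of _ B]) auto
qed

text \<open>\<open>Z\<close> contains two points that differ by a positive multiple of
  \<open>d\<close>, so its width in that direction is positive. This is the source of strictness for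
  the minimizer.\<close>

lemma support_fun_width_pos:
  assumes "bounded Z" "interior Z \<noteq> {}" "d \<noteq> 0"
  shows "0 < support_fun Z d + support_fun Z (- d)"
proof -
  obtain x e where e: "e > 0" "cball x e \<subseteq> Z"
    using assms(2) by (metis ex_in_conv mem_interior_cball)
  define w where "w = (e / norm d) *\<^sub>R d"
  have "norm w = e" using assms(3) e by (simp add: w_def)
  then have "x + w \<in> Z" "x \<in> Z" using e by (auto simp: dist_norm)
  then have "d \<bullet> (x + w) \<le> support_fun Z d" "(- d) \<bullet> x \<le> support_fun Z (- d)"
    by (auto intro: support_fun_upper[OF assms(1)] simp del: inner_minus_left)
  moreover have "0 < d \<bullet> w"
    using assms(3) e by (simp add: w_def)
  ultimately show ?thesis
    by (simp add: inner_add_right)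
qed

lemma opt_val_eq_support_fun: "opt_val Z y = - support_fun Z (- y)"
  by (simp add: opt_val_def support_fun_def Inf_real_def image_image)

lemma mem_opt_set_iff: "z \<in> opt_set Z y \<longleftrightarrow> z \<in> Z \<and> (\<forall>w\<in>Z. y \<bullet> z \<le> y \<bullet> w)"
  by (auto simp: opt_set_def argmin_on_def is_arg_min_def not_less)

lemma opt_set_scaleR: "0 < t \<Longrightarrow> opt_set Z (t *\<^sub>R y) = opt_set Z y"
  by (auto simp: mem_opt_set_iff)

lemma support_fun_opt_set:
  assumes "bounded Z" "z \<in> opt_set Z (- u)"
  shows "support_fun Z u = u \<bullet> z"
proof (rule antisym)
  show "support_fun Z u \<le> u \<bullet> z"
    using assms(2) by (intro support_fun_least) (auto simp: mem_opt_set_iff)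
  show "u \<bullet> z \<le> support_fun Z u"
    using assms by (intro support_fun_upper) (auto simp: mem_opt_set_iff)
qed

text \<open>A maximizer of \<open>u\<close> over \<open>Z\<close> is a subgradient of the support
  function at \<open>u\<close>; the sign in \<open>- u\<close> is there because
  \<open>opt_set\<close> minimizes.\<close>

lemma support_fun_subgradient:
  assumes "bounded Z" "z \<in> opt_set Z (- u)"
  shows "support_fun Z u + (v - u) \<bullet> z \<le> support_fun Z v"
  using support_fun_opt_set[OF assms] support_fun_upper[OF assms(1), of z v] assms(2)
  by (simp add: mem_opt_set_iff inner_diff_left)

lemma spo_plus_loss_eq:
  "spo_plus_loss Z zstar 1 yhat y =
     support_fun Z (y - yhat) + zstar y \<bullet> yhat - opt_val Z y"
  by (simp add: spo_plus_loss_def support_fun_def inner_diff_left)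

section \<open>Almost everywhere unique optima over a polytope\<close>

text \<open>The gap at a point of the hull is a convex combination of the gaps at points of
  \<open>V\<close>, which are positive except at \<open>v\<close>. A zero gap therefore puts all the
  weight on \<open>v\<close>.\<close>

lemma opt_set_convex_hull_unique:
  assumes V: "finite V" "v \<in> V" and less: "\<And>u. u \<in> V - {v} \<Longrightarrow> y \<bullet> v < y \<bullet> u"
  shows "opt_set (convex hull V) y = {v}"
proof -
  have strict: "y \<bullet> v \<le> y \<bullet> z \<and> (y \<bullet> z \<le> y \<bullet> v \<longrightarrow> z = v)" if "z \<in> convex hull V" for z
  proof -
    have "\<exists>a. (\<forall>x\<in>V. 0 \<le> a x) \<and> sum a V = 1 \<and> (\<Sum>x\<in>V. a x *\<^sub>R x) = z"
      using that unfolding convex_hull_finite[OF V(1)] by (rule CollectD)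
    then obtain a where a: "\<forall>x\<in>V. 0 \<le> a x" "sum a V = 1" "(\<Sum>x\<in>V. a x *\<^sub>R x) = z"
      by (elim exE conjE)
    have "y \<bullet> z - y \<bullet> v = (\<Sum>x\<in>V. a x * (y \<bullet> x)) - sum a V * (y \<bullet> v)"
      unfolding a(3)[symmetric] by (simp add: a(2) inner_sum_right)
    also have "\<dots> = (\<Sum>x\<in>V. a x * (y \<bullet> x - y \<bullet> v))"
      by (simp add: sum_distrib_right sum_subtractf algebra_simps)
    finally have eq: "y \<bullet> z - y \<bullet> v = (\<Sum>x\<in>V. a x * (y \<bullet> x - y \<bullet> v))" .
    have nonneg: "0 \<le> a x * (y \<bullet> x - y \<bullet> v)" if "x \<in> V" for x
      using a(1) less[of x] that by (cases "x = v") auto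
    have sum_pos: "0 \<le> (\<Sum>x\<in>V. a x * (y \<bullet> x - y \<bullet> v))"
      by (rule sum_nonneg) (rule nonneg)
    have "z = v" if "y \<bullet> z \<le> y \<bullet> v"
    proof -
      have "(\<Sum>x\<in>V. a x * (y \<bullet> x - y \<bullet> v)) = 0"
        using eq that sum_pos by linarith
      then have "\<forall>x\<in>V. a x * (y \<bullet> x - y \<bullet> v) = 0"
        using sum_nonneg_eq_0_iff[OF V(1) nonneg] by auto
      then have zero: "a x = 0" if "x \<in> V - {v}" for x
        using less[OF that] that by auto
      have "a v = 1"
        using a(2) zero sum.remove[OF V, of a] by simp
      then show "z = v"
        using a(3) zero sum.remove[OF V, of "\<lambda>x. a x *\<^sub>R x"] by simp
    qed
    then show ?thesis
      using eq sum_pos by auto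
  qed
  have "v \<in> convex hull V"
    using V(2) by (rule hull_inc)
  then show ?thesis
    using strict by (auto simp: mem_opt_set_iff)
qed

lemma AE_lborel_inner_ne_zero:
  fixes a :: "'a::euclidean_space"
  assumes "a \<noteq> 0"
  shows "AE y in lborel. y \<bullet> a \<noteq> 0"
proof -
  have "negligible {x. a \<bullet> x = 0}"
    using assms by (intro negligible_hyperplane) auto
  then have "{x. a \<bullet> x = 0} \<in> null_sets lborel"
    by (subst null_sets_completion_iff[symmetric])
       (auto simp: negligible_iff_null_sets intro!: borel_closed closed_hyperplane)
  then show ?thesis
    by (rule AE_I') (auto simp: inner_commute)
qed

text \<open>An arbitrary selection of optima need not be measurable; a bounded Borel
  \<open>w\<close> that agrees with it almost everywhere takes its place. Ties between generators of
  \<open>Z\<close> occur only on finitely many hyperplanes.\<close>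

lemma AE_lborel_opt_set_polytope:
  fixes Z :: "'a::euclidean_space set"
  assumes "polytope Z" "Z \<noteq> {}"
  shows "\<exists>w\<in>borel_measurable borel. (\<exists>C. \<forall>y. norm (w y) \<le> C) \<and>
           (AE y in lborel. opt_set Z y = {w y})"
proof -
  obtain V where V: "finite V" "Z = convex hull V"
    using assms(1) unfolding polytope_def by blast
  have [simp]: "V \<noteq> {}" using V assms(2) by auto
  \<comment> \<open>At most one summand is nonzero, since a strict minimizer over \<open>V\<close>
    is unique; where the minimum is tied the sum is 0. Measurability and the bound can be read off
    summand by summand.\<close>
  define w where "w y = (\<Sum>v\<in>V. if \<forall>u\<in>V - {v}. y \<bullet> v < y \<bullet> u then v else 0)" for y
  have "w \<in> borel_measurable borel"
    unfolding w_def using V(1)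
    by (intro borel_measurable_sum measurable_If pred_intros_finite predE) auto
  moreover have "norm (w y) \<le> (\<Sum>v\<in>V. norm v)" for y
    unfolding w_def by (rule sum_norm_le) auto
  moreover have "AE y in lborel. \<forall>v\<in>V. \<forall>u\<in>V - {v}. y \<bullet> (v - u) \<noteq> 0"
    using V(1) by (intro AE_finite_allI AE_lborel_inner_ne_zero) auto
  then have "AE y in lborel. opt_set Z y = {w y}"
  proof eventually_elim
    case (elim y)
    obtain v where v: "v \<in> V" "\<And>u. u \<in> V \<Longrightarrow> y \<bullet> v \<le> y \<bullet> u"
      using finite_has_minimal[of "(\<lambda>v. y \<bullet> v) ` V"] V(1)
      by (smt (verit, best) \<open>V \<noteq> {}\<close> arg_min_least arg_min_if_finite(1))
    have less: "y \<bullet> v < y \<bullet> u" if "u \<in> V - {v}" for u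
      using elim v that by (force simp: inner_diff_right less_le)
    have "w y = (\<Sum>x\<in>V. if x = v then v else 0)"
      unfolding w_def
    proof (rule sum.cong)
      fix x assume x: "x \<in> V"
      show "(if \<forall>u\<in>V - {x}. y \<bullet> x < y \<bullet> u then x else 0) = (if x = v then v else 0)"
      proof (cases "x = v")
        case True
        then show ?thesis using less by simp
      next
        case False
        then have "v \<in> V - {x}" "\<not> y \<bullet> x < y \<bullet> v"
          using less[of x] x v(1) by auto
        with False show ?thesis by auto
      qed
    qed simp
    also have "\<dots> = v"
      using V(1) v(1) by simp
    finally show ?case
      using opt_set_convex_hull_unique[OF V(1) v(1) less] V(2) by simp
  qed
  ultimately show ?thesis by blast
qed

section \<open>Measures with a density positive around a point\<close>

text \<open>A nonempty open subset of \<open>U\<close> has positive Lebesgue measure, and the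
  positive density keeps it from being null for \<open>M\<close>.\<close>

lemma not_AE_has_density_positive_around:
  fixes M :: "'a::euclidean_space measure"
  assumes "has_density_positive_around M c"
  shows "\<exists>U. open U \<and> c \<in> U \<and>
    (\<forall>W. open W \<longrightarrow> W \<inter> U \<noteq> {} \<longrightarrow> \<not> (AE y in M. y \<notin> W))"
proof -
  obtain f U where f: "f \<in> borel_measurable lborel" "M = density lborel f"
    and U: "open U" "c \<in> U" "\<forall>y\<in>U. 0 < f y"
    using assms unfolding has_density_positive_around_def by blast
  have "\<not> (AE y in M. y \<notin> W)" if W: "open W" "W \<inter> U \<noteq> {}" for W
  proof
    assume "AE y in M. y \<notin> W"
    then have "AE y in lborel. 0 < f y \<longrightarrow> y \<notin> W"
      unfolding f(2) AE_density[OF f(1)] .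
    then have "AE y in lborel. y \<notin> W \<inter> U"
      by eventually_elim (use U in auto)
    then have "W \<inter> U \<in> null_sets lborel"
      using W(1) U(1) by (subst AE_iff_null_sets) (auto intro: borel_open)
    then have "negligible (W \<inter> U)"
      by (simp add: negligible_iff_null_sets null_sets_completionI)
    then show False
      using open_not_negligible[of "W \<inter> U"] W U(1) by auto
  qed
  with U show ?thesis by blast
qed

lemma AE_has_density_positive_around:
  assumes "has_density_positive_around M c" "AE y in lborel. Q y"
  shows "AE y in M. Q y"
proof -
  obtain f where f: "f \<in> borel_measurable lborel" "M = density lborel f"
    using assms(1) unfolding has_density_positive_around_def by blast
  show ?thesis
    unfolding f(2) AE_density[OF f(1)] using assms(2) by auto
qed

text \<open>Translating both sides of the symmetry by \<open>c\<close> turns it into invariance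
  under a point reflection, the form used for changes of variables.\<close>

lemma centrally_symmetric_distr:
  fixes M :: "'a::euclidean_space measure"
  assumes sets: "sets M = sets borel" and "centrally_symmetric M c"
  shows "distr M borel (\<lambda>y. 2 *\<^sub>R c - y) = M"
proof -
  have meas: "(\<lambda>y. y - c) \<in> M \<rightarrow>\<^sub>M borel" "(\<lambda>y. c - y) \<in> M \<rightarrow>\<^sub>M borel"
    by (auto simp: measurable_cong_sets[OF sets refl])
  have "distr (distr M borel (\<lambda>y. c - y)) borel (\<lambda>y. y + c) =
        distr (distr M borel (\<lambda>y. y - c)) borel (\<lambda>y. y + c)"
    using assms(2) by (simp add: centrally_symmetric_def)
  then have "distr M borel (\<lambda>y. 2 *\<^sub>R c - y) = distr M borel (\<lambda>y. y)"
    using meas by (simp add: distr_distr comp_def scaleR_2 algebra_simps)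
  then show ?thesis
    using distr_id2[OF sets[symmetric]] by simp
qed

section \<open>The conditional risks\<close>

context
  fixes M :: "'a::euclidean_space measure" and c :: 'a and Z :: "'a set"
    and zstar :: "'a \<Rightarrow> 'a"
  assumes prob: "prob_space M" and sets_M: "sets M = sets borel"
    and Z: "polyhedron Z" "bounded Z" "interior Z \<noteq> {}"
    and zstar: "\<And>y. zstar y \<in> opt_set Z y"
    and sym: "centrally_symmetric M c"
    and int: "integrable M (\<lambda>y. y)"
    and dens: "has_density_positive_around M (2 *\<^sub>R c)"
begin

interpretation prob_space M by (rule prob)

lemma Z_nonempty: "Z \<noteq> {}"
  using Z(3) interior_subset by fastforce

lemma Z_compact: "compact Z"
  using Z by (simp add: compact_eq_bounded_closed polyhedron_imp_closed)

lemma integrable_opt_val: "integrable M (opt_val Z)"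
  unfolding opt_val_eq_support_fun
  by (intro Bochner_Integration.integrable_minus integrable_support_fun Z Z_nonempty int)

text \<open>The excess risk is the mean of an almost everywhere nonnegative \<open>D\<close>. Were
  it zero, \<open>D\<close> would vanish almost everywhere, but its lower bound \<open>G\<close> is
  positive on an open set that is not null.\<close>

lemma spo_plus_risk_unique_minimizer:
  assumes "yhat \<noteq> 2 *\<^sub>R c"
  shows "risk M (spo_plus_loss Z zstar 1) (2 *\<^sub>R c) < risk M (spo_plus_loss Z zstar 1) yhat"
proof -
  let ?h = "support_fun Z"
  have borel_M: "borel_measurable M = (borel_measurable borel :: ('a \<Rightarrow> 'b::topological_space) set)"
    using measurable_cong_sets[OF sets_M refl] .
  obtain w C where w: "w \<in> borel_measurable borel" "\<And>y. norm (w y) \<le> C"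
    "AE y in lborel. opt_set Z y = {w y}"
    using AE_lborel_opt_set_polytope[of Z] Z Z_nonempty
    by (auto simp: polytope_eq_bounded_polyhedron)
  have zw: "AE y in M. zstar y = w y"
    using AE_has_density_positive_around[OF dens w(3)]
    by eventually_elim (use zstar in blast)
  have int_w: "integrable M w"
    by (rule integrable_const_bound[of _ C]) (use w borel_M in auto)
  have distr_refl: "distr M borel (\<lambda>y. 2 *\<^sub>R c - y) = M"
    by (rule centrally_symmetric_distr[OF sets_M sym])
  have meas_refl: "(\<lambda>y. 2 *\<^sub>R c - y) \<in> M \<rightarrow>\<^sub>M borel"
    by (simp add: measurable_cong_sets[OF sets_M refl])
  \<comment> \<open>\<open>L\<close> equals the loss almost everywhere, with the Borel function
    \<open>w\<close> in place of \<open>zstar\<close>, so its integral splits into terms.\<close>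
  define L where "L u y = ?h (y - u) + w y \<bullet> u - opt_val Z y" for u y
  have int_h: "integrable M (\<lambda>y. ?h (y - u))" for u
    by (intro integrable_support_fun Z Z_nonempty Bochner_Integration.integrable_diff int) simp
  have int_L: "integrable M (L u)" for u
    unfolding L_def
    by (intro Bochner_Integration.integrable_diff Bochner_Integration.integrable_add int_h
        integrable_inner_left int_w integrable_opt_val)
  have eq_L: "AE y in M. spo_plus_loss Z zstar 1 u y = L u y" for u
    using zw by eventually_elim (simp add: spo_plus_loss_eq L_def)
  have L_nonneg: "AE y in M. 0 \<le> L u y" for u
    using eq_L[of u] by eventually_elim (metis spo_plus_loss_nonneg Z_compact zstar)
  have risk_eq: "risk M (spo_plus_loss Z zstar 1) u = ennreal (\<integral>y. L u y \<partial>M)" for u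
  proof -
    have "risk M (spo_plus_loss Z zstar 1) u = (\<integral>\<^sup>+ y. ennreal (L u y) \<partial>M)"
      unfolding risk_def using eq_L[of u] by (intro nn_integral_cong_AE) auto
    also have "\<dots> = ennreal (\<integral>y. L u y \<partial>M)"
      by (rule nn_integral_eq_integral[OF int_L L_nonneg])
    finally show ?thesis .
  qed
  define d where "d = 2 *\<^sub>R c - yhat"
  have d: "d \<noteq> 0" using assms by (simp add: d_def)
  \<comment> \<open>the excess of \<open>h\<close> over its tangent at \<open>y - 2 c\<close>, whose slope is \<open>zstar (2 c - y)\<close>\<close>
  define D where "D y = ?h (y - yhat) - ?h (y - 2 *\<^sub>R c) - d \<bullet> w (2 *\<^sub>R c - y)" for y
  have int_w': "integrable M (\<lambda>y. w (2 *\<^sub>R c - y))"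
    using int_w integrable_distr_eq[OF meas_refl, of w] w(1) distr_refl by simp
  \<comment> \<open>The reflection changes \<open>w\<close> but not its mean. After this exchange
    the integrand is nonnegative almost everywhere by convexity, not merely on average.\<close>
  have "(\<integral>y. w (2 *\<^sub>R c - y) \<partial>M) = (\<integral>y. w y \<partial>M)"
    using integral_distr[OF meas_refl w(1)] distr_refl by simp
  then have D_eq: "(\<integral>y. L yhat y \<partial>M) - (\<integral>y. L (2 *\<^sub>R c) y \<partial>M) = (\<integral>y. D y \<partial>M)"
    unfolding L_def D_def
    using int_h int_w int_w' integrable_opt_val
    by (simp add: integral_inner_left integral_inner_right d_def inner_diff_left inner_diff_right inner_commute algebra_simps)
  have int_D: "integrable M D"
    unfolding D_def using int_h int_w' by auto
  have "AE y in distr M borel (\<lambda>y. 2 *\<^sub>R c - y). opt_set Z y = {w y}"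
    unfolding distr_refl by (rule AE_has_density_positive_around[OF dens w(3)])
  from AE_distrD[OF meas_refl this]
  \<comment> \<open>One null set serves all \<open>t\<close>: the case \<open>t = 1\<close> gives
    \<open>0 \<le> D y\<close>, a smaller \<open>t\<close> gives the comparison with
    \<open>G\<close>.\<close>
  have tangent: "AE y in M. \<forall>t\<ge>0.
      ?h (y - 2 *\<^sub>R c) + t * (d \<bullet> w (2 *\<^sub>R c - y)) \<le> ?h (y - 2 *\<^sub>R c + t *\<^sub>R d)"
  proof eventually_elim
    case (elim y)
    then have "w (2 *\<^sub>R c - y) \<in> opt_set Z (- (y - 2 *\<^sub>R c))"
      by simp
    from support_fun_subgradient[OF Z(2) this, of "y - 2 *\<^sub>R c + _ *\<^sub>R d"]
    show ?case
      by simp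
  qed
  have D_nonneg: "AE y in M. 0 \<le> D y"
    using tangent
  proof eventually_elim
    case (elim y)
    from elim[rule_format, of 1] show ?case
      by (simp add: D_def d_def)
  qed
  have "\<not> (AE y in M. D y = 0)"
  proof
    assume zero: "AE y in M. D y = 0"
    obtain U where U: "open U" "2 *\<^sub>R c \<in> U"
      "\<And>W. open W \<Longrightarrow> W \<inter> U \<noteq> {} \<Longrightarrow> \<not> (AE y in M. y \<notin> W)"
      using not_AE_has_density_positive_around[OF dens] by blast
    obtain e where e: "e > 0" "ball (2 *\<^sub>R c) e \<subseteq> U"
      using U(1,2) open_contains_ball by blast
    \<comment> \<open>The bound \<open>1/2\<close> keeps \<open>1 - t\<close> positive; the other
      keeps \<open>2 *\<^sub>R c - t *\<^sub>R d\<close> within \<open>e / 2\<close> of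
      \<open>2 *\<^sub>R c\<close>.\<close>
    define t where "t = min (1/2) (e / (2 * norm d))"
    have t: "0 < t" "t < 1" using e d by (auto simp: t_def)
    have "t * norm d \<le> e / (2 * norm d) * norm d"
      by (intro mult_right_mono) (auto simp: t_def)
    then have "t * norm d < e" using d e by simp
    then have in_U: "2 *\<^sub>R c - t *\<^sub>R d \<in> U"
      using t e(2) by (auto simp: dist_norm subset_iff)
    \<comment> \<open>\<open>G\<close> bounds \<open>D\<close> from below, replacing the slope at \<open>y - 2 c\<close> by a difference quotient,
      so that it is continuous. At \<open>y = 2 c - t d\<close> it is \<open>(1 - t) (h d + h (- d))\<close>.\<close>
    define G where "G y = ?h (y - yhat) - ?h (y - 2 *\<^sub>R c)
      - (?h (y - 2 *\<^sub>R c + t *\<^sub>R d) - ?h (y - 2 *\<^sub>R c)) / t" for y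
    have cont: "continuous_on UNIV (\<lambda>y. ?h (y + a))" for a
      by (rule continuous_on_compose2[OF continuous_on_support_fun[OF Z(2) Z_nonempty]])
         (auto intro!: continuous_intros)
    have "continuous_on UNIV G"
      unfolding G_def using t cont[of "- yhat"] cont[of "- (2 *\<^sub>R c)"] cont[of "- (2 *\<^sub>R c) + t *\<^sub>R d"]
      by (intro continuous_intros) (simp_all add: algebra_simps)
    then have "open {y. 0 < G y}"
      by (intro open_Collect_less continuous_on_const)
    moreover have "0 < G (2 *\<^sub>R c - t *\<^sub>R d)"
    proof -
      \<comment> \<open>At this point the arguments of \<open>?h\<close> run from
        \<open>- t *\<^sub>R d\<close> to \<open>(1 - t) *\<^sub>R d\<close>, crossing the kink at
        the origin; positive homogeneity evaluates each term.\<close>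
      have "2 *\<^sub>R c - t *\<^sub>R d - yhat = (1 - t) *\<^sub>R d"
        by (simp add: d_def algebra_simps)
      moreover have "?h (- (t *\<^sub>R d)) = t * ?h (- d)"
        using support_fun_scaleR[OF Z(2) Z_nonempty, of t "- d"] t by simp
      ultimately have "G (2 *\<^sub>R c - t *\<^sub>R d) = (1 - t) * (?h d + ?h (- d))"
        using t support_fun_scaleR[OF Z(2) Z_nonempty, of "1 - t" d]
        by (simp add: G_def support_fun_zero[OF Z_nonempty] algebra_simps)
      then show ?thesis
        using t support_fun_width_pos[OF Z(2,3) d] by simp
    qed
    ultimately have "\<not> (AE y in M. y \<notin> {y. 0 < G y})"
      using in_U by (intro U(3)) auto
    moreover have "AE y in M. y \<notin> {y. 0 < G y}"
      using zero tangent
    proof eventually_elim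
      case (elim y)
      \<comment> \<open>The tangent inequality divided by \<open>t\<close> bounds the slope by the
        difference quotient.\<close>
      have "d \<bullet> w (2 *\<^sub>R c - y) \<le> (?h (y - 2 *\<^sub>R c + t *\<^sub>R d) - ?h (y - 2 *\<^sub>R c)) / t"
        using elim(2)[rule_format, of t] t by (simp add: field_simps)
      then have "G y \<le> D y"
        by (simp add: G_def D_def)
      then show ?case
        using elim(1) by simp
    qed
    ultimately show False by blast
  qed
  then have "(\<integral>y. D y \<partial>M) \<noteq> 0"
    using integral_nonneg_eq_0_iff_AE[OF int_D D_nonneg] by simp
  then have "0 < (\<integral>y. D y \<partial>M)"
    using integral_nonneg_AE[OF D_nonneg] by simp
  with D_eq have "(\<integral>y. L (2 *\<^sub>R c) y \<partial>M) < (\<integral>y. L yhat y \<partial>M)"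
    by simp
  then show ?thesis
    unfolding risk_eq using integral_nonneg_AE[OF L_nonneg] by (simp add: ennreal_less_iff)
qed

text \<open>The mean regret of a fixed decision depends on its cost only through \<open>c\<close>,
  so \<open>z0\<close> is the best one. The risk at \<open>yhat\<close> is at least the regret of
  \<open>zstar yhat\<close>, and at \<open>2 *\<^sub>R c\<close> the only optimal decision is
  \<open>z0\<close>.\<close>

lemma spo_risk_minimizer:
  assumes c: "c = (\<integral>y. y \<partial>M)" and unique: "\<exists>!z. z \<in> opt_set Z c"
  shows "risk M (spo_loss Z) (2 *\<^sub>R c) \<le> risk M (spo_loss Z) yhat"
proof -
  have int_z: "integrable M (\<lambda>y. y \<bullet> z - opt_val Z y)" for z
    by (intro Bochner_Integration.integrable_diff integrable_inner_left int integrable_opt_val)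
  have val: "(\<integral>\<^sup>+ y. ennreal (y \<bullet> z - opt_val Z y) \<partial>M) =
      ennreal (c \<bullet> z - (\<integral>y. opt_val Z y \<partial>M))" if "z \<in> Z" for z
  proof -
    have "0 \<le> y \<bullet> z - opt_val Z y" for y
      using support_fun_upper[OF Z(2) that, of "- y"] by (simp add: opt_val_eq_support_fun)
    then show ?thesis
      using int integrable_opt_val by (simp add: nn_integral_eq_integral[OF int_z] c)
  qed
  obtain z0 where z0: "opt_set Z c = {z0}"
    using unique by auto
  have "spo_loss Z (2 *\<^sub>R c) y = y \<bullet> z0 - opt_val Z y" for y
    by (simp add: spo_loss_def opt_set_scaleR z0)
  then have "risk M (spo_loss Z) (2 *\<^sub>R c) = (\<integral>\<^sup>+ y. ennreal (y \<bullet> z0 - opt_val Z y) \<partial>M)"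
    by (simp add: risk_def)
  also have "\<dots> \<le> (\<integral>\<^sup>+ y. ennreal (y \<bullet> zstar yhat - opt_val Z y) \<partial>M)"
  proof -
    have "z0 \<in> opt_set Z c" "zstar yhat \<in> Z"
      using z0 zstar[of yhat] by (auto simp: mem_opt_set_iff)
    then show ?thesis
      by (simp add: mem_opt_set_iff val ennreal_leI)
  qed
  also have "\<dots> \<le> risk M (spo_loss Z) yhat"
    unfolding risk_def
  proof (intro nn_integral_mono ennreal_leI)
    fix y
    have "bounded (opt_set Z yhat)"
      using Z(2) by (rule bounded_subset) (auto simp: mem_opt_set_iff)
    from support_fun_upper[OF this zstar, of y]
    show "y \<bullet> zstar yhat - opt_val Z y \<le> spo_loss Z yhat y"
      by (simp add: spo_loss_def support_fun_def)
  qed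
  finally show ?thesis .
qed

end

section \<open>Fisher consistency for almost every covariate\<close>

theorem corollary2:
  fixes X :: "(real ^ 'p) set"
    and P :: "((real ^ 'p) \<times> (real ^ 'd)) measure"
    and K :: "real ^ 'p \<Rightarrow> (real ^ 'd) measure"
    and Z :: "(real ^ 'd) set"
    and zstar :: "real ^ 'd \<Rightarrow> real ^ 'd"
  assumes "prob_space P"
    and "sets P = sets (restrict_space borel X \<Otimes>\<^sub>M borel)"
    and "conditional_distribution X P K"
    and "polyhedron Z" and "bounded Z" and "interior Z \<noteq> {}"
    and "\<And>y. zstar y \<in> opt_set Z y"
    and "AE x in marginal_x X P.
           let ybar = (\<integral>y. y \<partial>K x) in
             centrally_symmetric (K x) ybar \<and>
             integrable (K x) (\<lambda>y. norm y) \<and>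
             has_density_positive_around (K x) (2 *\<^sub>R ybar) \<and>
             (\<exists>!z. z \<in> opt_set Z ybar)"
  shows "fisher_consistent (marginal_x X P) K (spo_plus_loss Z zstar 1) (spo_loss Z)"
  unfolding fisher_consistent_def
  using assms(8) AE_space
proof eventually_elim
  case (elim x)
  define c where "c = (\<integral>y. y \<partial>K x)"
  \<comment> \<open>\<open>K\<close> is known to give probability measures only on the space of the
    restricted Borel algebra, hence the use of \<open>AE_space\<close>.\<close>
  have "x \<in> space (restrict_space borel X)"
    using elim(2) by (simp add: marginal_x_def)
  then have K: "prob_space (K x)" "sets (K x) = sets borel"
    using assms(3) unfolding conditional_distribution_def
    by (auto dest!: measurable_space simp: space_prob_algebra)
  have c: "centrally_symmetric (K x) c" "integrable (K x) (\<lambda>y. norm y)"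
    "has_density_positive_around (K x) (2 *\<^sub>R c)" "\<exists>!z. z \<in> opt_set Z c"
    using elim(1) by (auto simp: Let_def c_def)
  have int: "integrable (K x) (\<lambda>y. y)"
    using c(2) by (subst integrable_norm_iff[symmetric])
      (auto simp: measurable_cong_sets[OF K(2) refl])
  note ctxt = K assms(4-7) c(1) int c(3)
  show ?case
  proof
    fix u assume "u \<in> argmin_on UNIV (risk (K x) (spo_plus_loss Z zstar 1))"
    then have "\<not> risk (K x) (spo_plus_loss Z zstar 1) (2 *\<^sub>R c) < risk (K x) (spo_plus_loss Z zstar 1) u"
      by (auto simp: argmin_on_def is_arg_min_def)
    \<comment> \<open>A minimizer other than \<open>2 *\<^sub>R c\<close> would be strictly beaten
      by it.\<close>
    then have "u = 2 *\<^sub>R c"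
      using spo_plus_risk_unique_minimizer[OF ctxt] by blast
    then show "u \<in> argmin_on UNIV (risk (K x) (spo_loss Z))"
      using spo_risk_minimizer[OF ctxt c_def c(4)]
      by (auto simp: argmin_on_def is_arg_min_def not_less)
  qed
qed

end
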